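(* Let $n\in\{1,2,3,\dots\}$ and let $X$ be a finite $1$-homogeneous metric space with $n$ points. Then $\delta(X)\le n$. We have $\delta(X)=n$ if and only if $X$ is isosceles-free, and in this case $X$ is ultrahomogeneous and $n$ is a power of two. In other words, $\Delta_\omega(n)=\Delta_1(n)=n$ if $n=2^m$ for some integer $m\ge 0$, and $\Delta_1(n)<n$ otherwise.
   Context: An isometry is a bijective distance-preserving map; $\operatorname{Aut}(X)$ is the group of all isometries $X\to X$. A metric space $X$ is $k$-homogeneous if every isometry $f\colon A\to B$ between subspaces $A,B\subseteq X$ with $|A|\le k$ extends to some $F\in\operatorname{Aut}(X)$; it is ultrahomogeneous if it is $k$-homogeneous for every $k\ge1$. $X$ is isosceles-free if $d(x,y)\ne d(x,z)$ for all pairwise distinct $x,y,z\in X$. Let $\delta(X)$ be the number of distinct values $d(x,y)$, $x,y\in X$ (including the value $0$). For $k,n\ge1$, $\Delta_k(n)$ is the maximum of $\delta(X)$ over all $k$-homogeneous metric spaces $X$ with $|X|=n$, and $\Delta_\omega(n)$ is the maximum of $\delta(X)$ over all ultrahomogeneous metric spaces $X$ with $|X|=n$. *)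

theory Defs
  imports "HOL-Analysis.Analysis"
begin

definition isometry :: "'a metric \<Rightarrow> 'b metric \<Rightarrow> ('a \<Rightarrow> 'b) \<Rightarrow> bool" where
  "isometry X Y f \<longleftrightarrow>
     bij_betw f (mspace X) (mspace Y) \<and>
     (\<forall>x\<in>mspace X. \<forall>y\<in>mspace X. mdist Y (f x) (f y) = mdist X x y)"

(* The values of F outside mspace X are unconstrained, so an automorphism of X may be
   represented by several functions; only existence of automorphisms is ever used. *)
definition Aut :: "'a metric \<Rightarrow> ('a \<Rightarrow> 'a) set" where
  "Aut X = {F. isometry X X F}"

definition k_homogeneous :: "nat \<Rightarrow> 'a metric \<Rightarrow> bool" where
  "k_homogeneous k X \<longleftrightarrow>
     (\<forall>A B f. A \<subseteq> mspace X \<longrightarrow> B \<subseteq> mspace X \<longrightarrow> finite A \<longrightarrow> card A \<le> k \<longrightarrow>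
        isometry (submetric X A) (submetric X B) f \<longrightarrow>
        (\<exists>F\<in>Aut X. \<forall>x\<in>A. F x = f x))"

definition ultrahomogeneous :: "'a metric \<Rightarrow> bool" where
  "ultrahomogeneous X \<longleftrightarrow> (\<forall>k\<ge>1. k_homogeneous k X)"

definition isosceles_free :: "'a metric \<Rightarrow> bool" where
  "isosceles_free X \<longleftrightarrow>
     (\<forall>x\<in>mspace X. \<forall>y\<in>mspace X. \<forall>z\<in>mspace X.
        x \<noteq> y \<longrightarrow> x \<noteq> z \<longrightarrow> y \<noteq> z \<longrightarrow> mdist X x y \<noteq> mdist X x z)"

(* Only meaningful when there are finitely many distances (in particular for finite X),
   since card is 0 on infinite sets. *)
definition delta :: "'a metric \<Rightarrow> nat" where
  "delta X = card {mdist X x y | x y. x \<in> mspace X \<and> y \<in> mspace X}"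

(* The maxima range over metric spaces whose n points are natural numbers. This is no
   restriction: every finite metric space, over any type, is isometric to such a
   space. Lemmas Delta_ge, Delta_attained, Delta_omega_ge and Delta_omega_attained below show
   that Delta and Delta_omega are genuine maxima over all types. *)
definition Delta :: "nat \<Rightarrow> nat \<Rightarrow> nat" where
  "Delta k n = Max {delta X | X :: nat metric.
     finite (mspace X) \<and> card (mspace X) = n \<and> k_homogeneous k X}"

definition Delta_omega :: "nat \<Rightarrow> nat" where
  "Delta_omega n = Max {delta X | X :: nat metric.
     finite (mspace X) \<and> card (mspace X) = n \<and> ultrahomogeneous X}"

lemma delta_isometry:
  assumes "isometry X Y h"
  shows "delta Y = delta X"
proof -
  have im: "h ` mspace X = mspace Y"
    and d: "\<And>x y. x \<in> mspace X \<Longrightarrow> y \<in> mspace X \<Longrightarrow> mdist Y (h x) (h y) = mdist X x y"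
    using assms by (auto simp: isometry_def bij_betw_def)
  have "{mdist Y x y | x y. x \<in> mspace Y \<and> y \<in> mspace Y}
      = {mdist X x y | x y. x \<in> mspace X \<and> y \<in> mspace X}"
    unfolding im [symmetric] 
  proof (intro set_eqI iffI; clarify)
    fix x y assume "x \<in> mspace X" "y \<in> mspace X"
    then show "\<exists>x' y'. mdist Y (h x) (h y) = mdist X x' y' \<and> x' \<in> mspace X \<and> y' \<in> mspace X"
      using d by blast
  next
    fix x y assume "x \<in> mspace X" "y \<in> mspace X"
    then show "\<exists>x' y'. mdist X x y = mdist Y x' y' \<and> x' \<in> h ` mspace X \<and> y' \<in> h ` mspace X"
      using d[symmetric] by blast
  qed
  then show ?thesis
    by (simp add: delta_def)
qed

lemma isometry_comp:
  assumes "isometry X Y f" "isometry Y Z g"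
  shows "isometry X Z (g \<circ> f)"
  using assms unfolding isometry_def
  by (auto intro: bij_betw_trans dest: bij_betwE)

lemma isometry_inv:
  assumes "isometry X Y f"
  shows "isometry Y X (inv_into (mspace X) f)"
proof -
  have b: "bij_betw f (mspace X) (mspace Y)"
    using assms by (simp add: isometry_def)
  have "mdist X (inv_into (mspace X) f x) (inv_into (mspace X) f y) = mdist Y x y"
    if "x \<in> mspace Y" "y \<in> mspace Y" for x y
    using assms that bij_betw_inv_into_right[OF b] bij_betwE[OF bij_betw_inv_into[OF b]]
    unfolding isometry_def by metis
  then show ?thesis
    using bij_betw_inv_into[OF b] by (simp add: isometry_def)
qed

lemma isometry_restrict:
  assumes "isometry X Y h" "A \<subseteq> mspace X"
  shows "isometry (submetric X A) (submetric Y (h ` A)) h"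
proof -
  have "h ` A \<subseteq> mspace Y"
    using assms by (auto simp: isometry_def dest: bij_betwE)
  moreover have "bij_betw h A (h ` A)"
    using assms by (auto simp: isometry_def bij_betw_def intro: inj_on_subset)
  ultimately show ?thesis
    using assms by (auto simp: isometry_def Int_absorb2 subset_iff)
qed

lemma k_homogeneous_isometry:
  assumes h: "isometry X Y h" and X: "k_homogeneous k X"
  shows "k_homogeneous k Y"
  unfolding k_homogeneous_def
proof (intro allI impI)
  fix A B f
  assume A: "A \<subseteq> mspace Y" and B: "B \<subseteq> mspace Y" and fin: "finite A" and c: "card A \<le> k"
    and f: "isometry (submetric Y A) (submetric Y B) f"
  define g where "g = inv_into (mspace X) h"
  have bh: "bij_betw h (mspace X) (mspace Y)"
    using h by (simp add: isometry_def)
  have g: "isometry Y X g"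
    unfolding g_def using h by (rule isometry_inv)
  have hg: "h (g y) = y" if "y \<in> mspace Y" for y
    unfolding g_def using bij_betw_inv_into_right[OF bh] that by simp
  have gY: "g y \<in> mspace X" if "y \<in> mspace Y" for y
    using g that by (auto simp: isometry_def dest: bij_betwE)
  have hgA: "h ` (g ` A) = A"
    using A hg by (force simp: image_image)
  have sA: "g ` A \<subseteq> mspace X" and sB: "g ` B \<subseteq> mspace X"
    using gY A B by auto
  have "isometry (submetric X (g ` A)) (submetric Y A) h"
    using isometry_restrict[OF h sA] hgA by simp
  then have "isometry (submetric X (g ` A)) (submetric X (g ` B)) (g \<circ> (f \<circ> h))"
    by (intro isometry_comp[OF isometry_comp[OF _ f] isometry_restrict[OF g B]])
  moreover have "card (g ` A) \<le> k"
    using card_image_le[OF fin, of g] c by simp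
  ultimately have "\<exists>F\<in>Aut X. \<forall>x\<in>g ` A. F x = (g \<circ> (f \<circ> h)) x"
    by (intro X [unfolded k_homogeneous_def, rule_format, OF sA sB finite_imageI[OF fin]])
  then obtain F where F: "F \<in> Aut X" "\<And>x. x \<in> g ` A \<Longrightarrow> F x = (g \<circ> (f \<circ> h)) x"
    by blast
  have "isometry Y Y (h \<circ> (F \<circ> g))"
    using F(1) by (intro isometry_comp[OF isometry_comp[OF g] h]) (simp add: Aut_def)
  moreover have "(h \<circ> (F \<circ> g)) x = f x" if "x \<in> A" for x
  proof -
    have "f x \<in> B"
      using f that A B by (auto simp: isometry_def Int_absorb2 dest!: bij_betwE)
    then show ?thesis
      using F(2)[of "g x"] that A B hg by (auto simp: subset_iff)
  qed
  ultimately show "\<exists>F\<in>Aut Y. \<forall>x\<in>A. F x = f x"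
    unfolding Aut_def by blast
qed

lemma ex_nat_metric:
  fixes X :: "'a metric"
  assumes "finite (mspace X)"
  obtains Y :: "nat metric" and h where "isometry X Y h"
    "finite (mspace Y)" "card (mspace Y) = card (mspace X)"
proof -
  obtain h where h: "bij_betw h (mspace X) {0..<card (mspace X)}"
    using ex_bij_betw_finite_nat[OF assms] by blast
  define g where "g = inv_into (mspace X) h"
  define N where "N = {0..<card (mspace X)}"
  have g: "bij_betw g N (mspace X)"
    unfolding g_def N_def using h by (rule bij_betw_inv_into)
  have gh: "g (h x) = x" if "x \<in> mspace X" for x
    unfolding g_def using bij_betw_inv_into_left[OF h] that by simp
  have gN: "g i \<in> mspace X" if "i \<in> N" for i
    using g that by (auto dest: bij_betwE)
  interpret Metric_space N "\<lambda>i j. mdist X (g i) (g j)"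
  proof
    show "mdist X (g i) (g j) = 0 \<longleftrightarrow> i = j" if "i \<in> N" "j \<in> N" for i j
      using that gN bij_betw_imp_inj_on[OF g] by (simp add: inj_on_eq_iff)
  qed (use gN in \<open>auto simp: mdist_commute intro: mdist_triangle\<close>)
  show thesis
  proof
    show "isometry X Self h"
      using h gh by (simp add: isometry_def flip: N_def)
  qed (simp_all, simp_all add: N_def)
qed

lemma ex_ultrahomogeneous:
  obtains X :: "nat metric" where
    "finite (mspace X)" "card (mspace X) = n" "ultrahomogeneous X"
proof -
  interpret discrete_metric "{..<n}" .
  define X where "X = disc.Self"
  have ms: "mspace X = {..<n}" and d: "mdist X = dd"
    by (simp_all add: X_def)
  have "\<exists>F\<in>Aut X. \<forall>x\<in>A. F x = f x"
    if A: "A \<subseteq> mspace X" and B: "B \<subseteq> mspace X"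
      and f: "isometry (submetric X A) (submetric X B) f" for A B f
  proof -
    have bf: "bij_betw f A B"
      using f A B by (simp add: isometry_def Int_absorb2)
    have fin: "finite A" "finite B"
      using A B ms by (auto intro: finite_subset)
    have "card (mspace X - A) = card (mspace X - B)"
      using A B fin bij_betw_same_card[OF bf] by (simp add: card_Diff_subset)
    then obtain e where e: "bij_betw e (mspace X - A) (mspace X - B)"
      using ms by (metis finite_Diff finite_lessThan finite_same_card_bij)
    define F where "F x = (if x \<in> A then f x else e x)" for x
    have "bij_betw F A B" "bij_betw F (mspace X - A) (mspace X - B)"
      using bf e bij_betw_cong[of A F f] bij_betw_cong[of "mspace X - A" F e]
      by (simp_all add: F_def)
    then have "bij_betw F (A \<union> (mspace X - A)) (B \<union> (mspace X - B))"
      by (rule bij_betw_combine) auto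
    then have bF: "bij_betw F (mspace X) (mspace X)"
      using A B by (simp add: Un_absorb1)
    then have "isometry X X F"
      unfolding isometry_def using bij_betw_imp_inj_on[OF bF]
      by (auto simp: d dd_def inj_on_eq_iff)
    then show ?thesis
      by (auto simp: Aut_def F_def)
  qed
  then have "ultrahomogeneous X"
    by (auto simp: ultrahomogeneous_def k_homogeneous_def)
  then show thesis
    using that[of X] ms by simp
qed

lemma finite_deltas: "finite {delta X | X :: nat metric. finite (mspace X) \<and> card (mspace X) = n \<and> P X}"
proof -
  have "delta X \<le> n * n" if "finite (mspace X)" "card (mspace X) = n" for X :: "nat metric"
  proof -
    have "{mdist X x y | x y. x \<in> mspace X \<and> y \<in> mspace X}
        = (\<lambda>(x, y). mdist X x y) ` (mspace X \<times> mspace X)"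
      by auto
    then show ?thesis
      unfolding delta_def using card_image_le[of "mspace X \<times> mspace X" "\<lambda>(x, y). mdist X x y"] that
      by (simp add: card_cartesian_product)
  qed
  then have "{delta X | X :: nat metric. finite (mspace X) \<and> card (mspace X) = n \<and> P X} \<subseteq> {..n * n}"
    by auto
  then show ?thesis
    using finite_subset by blast
qed

lemma k_homogeneous_if_ultrahomogeneous:
  assumes "ultrahomogeneous X"
  shows "k_homogeneous k X"
proof -
  have "k_homogeneous (Suc k) X"
    using assms by (simp add: ultrahomogeneous_def)
  then show ?thesis
    by (simp add: k_homogeneous_def)
qed

lemma Delta_ge:
  assumes "finite (mspace X)" "card (mspace X) = n" "k_homogeneous k X"
  shows "delta X \<le> Delta k n"
proof -
  obtain Y :: "nat metric" and h where Y: "isometry X Y h"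
    "finite (mspace Y)" "card (mspace Y) = card (mspace X)"
    using ex_nat_metric[OF assms(1)] .
  have "delta Y \<le> Delta k n"
    unfolding Delta_def using Y assms k_homogeneous_isometry[OF Y(1)]
    by (intro Max_ge finite_deltas CollectI exI[of _ Y]) simp
  then show ?thesis
    using delta_isometry[OF Y(1)] by simp
qed

lemma Delta_attained:
  obtains X :: "nat metric" where
    "finite (mspace X)" "card (mspace X) = n" "k_homogeneous k X" "delta X = Delta k n"
proof -
  let ?S = "{delta X | X :: nat metric. finite (mspace X) \<and> card (mspace X) = n \<and> k_homogeneous k X}"
  obtain X :: "nat metric" where
    "finite (mspace X)" "card (mspace X) = n" "ultrahomogeneous X"
    by (rule ex_ultrahomogeneous)
  then have "delta X \<in> ?S"
    by (intro CollectI exI[of _ X]) (simp add: k_homogeneous_if_ultrahomogeneous)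
  then have "?S \<noteq> {}"
    by (metis empty_iff)
  then have "Max ?S \<in> ?S"
    by (rule Max_in[OF finite_deltas])
  then show thesis
    using that unfolding Delta_def by auto
qed

lemma Delta_omega_ge:
  assumes "finite (mspace X)" "card (mspace X) = n" "ultrahomogeneous X"
  shows "delta X \<le> Delta_omega n"
proof -
  obtain Y :: "nat metric" and h where Y: "isometry X Y h"
    "finite (mspace Y)" "card (mspace Y) = card (mspace X)"
    using ex_nat_metric[OF assms(1)] .
  have "ultrahomogeneous Y"
    using assms(3) k_homogeneous_isometry[OF Y(1)] by (auto simp: ultrahomogeneous_def)
  then have "delta Y \<le> Delta_omega n"
    unfolding Delta_omega_def using Y assms
    by (intro Max_ge finite_deltas CollectI exI[of _ Y]) simp
  then show ?thesis
    using delta_isometry[OF Y(1)] by simp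
qed

lemma Delta_omega_attained:
  obtains X :: "nat metric" where
    "finite (mspace X)" "card (mspace X) = n" "ultrahomogeneous X" "delta X = Delta_omega n"
proof -
  let ?S = "{delta X | X :: nat metric. finite (mspace X) \<and> card (mspace X) = n \<and> ultrahomogeneous X}"
  have "?S \<noteq> {}"
    using ex_ultrahomogeneous[of n] by blast
  then have "Max ?S \<in> ?S"
    by (rule Max_in[OF finite_deltas])
  then show thesis
    using that unfolding Delta_omega_def by auto
qed

end

theory Submission
  imports Defs "HOL-Algebra.Sylow" "HOL-Algebra.Multiplicative_Group"
begin

text \<open>
  In a finite 1-homogeneous space any point can be moved to any other, so the distances from a
  single point \<open>o'\<close> are already all the distances (\<open>delta_eq_card_distances_from_point\<close>). There are
  at most as many of them as points, and as many precisely when \<open>mdist X o'\<close> is injective; since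
  this holds for every choice of \<open>o'\<close>, equality means that the space is isosceles-free.

  In an isosceles-free space a point is determined by its distance from any other given point.
  A partial isometry therefore agrees with any automorphism that agrees with it at one point of its
  domain, and such an automorphism exists by 1-homogeneity: the space is ultrahomogeneous. For the
  same reason the automorphisms act simply transitively, and they are involutions because the
  distance is symmetric. The points thus form a group of exponent two, whose order is a power of two
  by Sylow's theorem (\<open>isosceles_free_imp_card_power_of_two\<close>).

  Conversely, \<open>2 ^ m\<close> distances are realized by the numbers below \<open>2 ^ m\<close> with their bitwise
  exclusive or as distance (\<open>ex_isosceles_free_homogeneous\<close>). By the first part this
  1-homogeneous space is even ultrahomogeneous, so it determines both extremal functions.
\<close>

section \<open>Groups of exponent two\<close>

lemma power_of_two_if_prime_divisors:
  fixes n :: nat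
  assumes "n > 0" and "\<And>p. prime p \<Longrightarrow> p dvd n \<Longrightarrow> p = 2"
  shows "\<exists>m. n = 2 ^ m"
proof -
  obtain k where k: "n = 2 ^ multiplicity 2 n * k" "\<not> 2 dvd k"
    using multiplicity_decompose'[of n "2::nat"] assms(1) by auto
  have "k = 1"
  proof (rule ccontr)
    assume "k \<noteq> 1"
    then obtain p where p: "prime p" "p dvd k"
      using prime_factor_nat by blast
    have "p dvd n"
      using p(2) by (subst k(1)) simp
    then have "p = 2"
      using assms(2) p(1) by blast
    then show False
      using p(2) k(2) by simp
  qed
  then show ?thesis
    using k(1) by (metis mult.right_neutral)
qed

text \<open>
  If an odd prime \<open>p\<close> divided the order, Sylow's theorem would give a subgroup of order \<open>p\<close>.
  The orders of its elements would divide both two and \<open>p\<close>, so it would be trivial.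
\<close>

lemma (in group) order_power_of_two_if_exponent_two:
  assumes fin: "finite (carrier G)"
    and inv: "\<And>x. x \<in> carrier G \<Longrightarrow> x \<otimes> x = \<one>"
  shows "\<exists>m. order G = 2 ^ m"
proof (rule power_of_two_if_prime_divisors)
  show "order G > 0"
    using fin by (simp add: order_gt_0_iff_finite)
next
  fix p assume p: "prime p" "p dvd order G"
  show "p = 2"
  proof (rule ccontr)
    assume "p \<noteq> 2"
    obtain H where H: "subgroup H G" "card H = p"
      using sylow_thm[OF p(1) is_group _ fin, of 1 "order G div p"] p(2) by auto
    have "x = \<one>" if x: "x \<in> H" for x
    proof -
      have xG: "x \<in> carrier G"
        using subgroup.mem_carrier[OF H(1)] x .
      interpret H: group "G\<lparr>carrier := H\<rparr>"
        using subgroup_imp_group[OF H(1)] .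
      have "x [^]\<^bsub>G\<lparr>carrier := H\<rparr>\<^esub> p = \<one>"
        using H.pow_order_eq_1[of x] x H(2) by (simp add: order_def)
      then have "x [^] p = \<one>"
        using nat_pow_consistent by metis
      then have "ord x dvd p"
        using pow_eq_id[OF xG] by blast
      moreover have "x [^] (2::nat) = \<one>"
        using inv xG by (simp add: numeral_2_eq_2)
      then have "ord x dvd 2"
        using pow_eq_id[OF xG] by blast
      ultimately have "ord x = 1"
        using p(1) \<open>p \<noteq> 2\<close> by (metis prime_nat_iff two_is_prime_nat)
      then show ?thesis
        using xG pow_ord_eq_1[OF xG] by simp
    qed
    then have "H \<subseteq> {\<one>}"
      by blast
    then have "card H \<le> 1"
      using card_mono[of "{\<one>}" H] by simp
    then show False
      using H(2) prime_gt_1_nat[OF p(1)] by simp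
  qed
qed

section \<open>Distances in a one-homogeneous space\<close>

lemma Aut_transitive:
  assumes "k_homogeneous 1 X" "x \<in> mspace X" "y \<in> mspace X"
  obtains F where "F \<in> Aut X" "F x = y"
proof -
  have "isometry (submetric X {x}) (submetric X {y}) (\<lambda>_. y)"
    using assms(2,3) by (simp add: isometry_def bij_betw_def mdist_zero[THEN iffD2])
  then have "\<exists>F\<in>Aut X. \<forall>z\<in>{x}. F z = y"
    using assms(2,3)
    by (intro assms(1)[unfolded k_homogeneous_def, rule_format, where B = "{y}"]) auto
  then show thesis
    using that by blast
qed

lemma Aut_mspace: "F \<in> Aut X \<Longrightarrow> x \<in> mspace X \<Longrightarrow> F x \<in> mspace X"
  by (auto simp: Aut_def isometry_def dest: bij_betwE)

lemma Aut_mdist: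
  "F \<in> Aut X \<Longrightarrow> x \<in> mspace X \<Longrightarrow> y \<in> mspace X \<Longrightarrow> mdist X (F x) (F y) = mdist X x y"
  by (simp add: Aut_def isometry_def)

text \<open>Every pair can be moved by an automorphism to a pair that starts at the base point.\<close>

lemma delta_eq_card_distances_from_point:
  assumes "k_homogeneous 1 X" "o' \<in> mspace X"
  shows "delta X = card (mdist X o' ` mspace X)"
proof -
  have "mdist X x y \<in> mdist X o' ` mspace X" if xy: "x \<in> mspace X" "y \<in> mspace X" for x y
  proof -
    obtain F where F: "F \<in> Aut X" "F x = o'"
      using Aut_transitive[OF assms(1) xy(1) assms(2)] .
    then have "mdist X x y = mdist X o' (F y)"
      using Aut_mdist[OF F(1) xy] by simp
    then show ?thesis
      using Aut_mspace[OF F(1) xy(2)] by blast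
  qed
  then have "{mdist X x y | x y. x \<in> mspace X \<and> y \<in> mspace X} = mdist X o' ` mspace X"
    using assms(2) by auto
  then show ?thesis
    by (simp add: delta_def)
qed

text \<open>
  A coincidence of distances from \<open>x\<close> between two points that include \<open>x\<close> itself
  is excluded already by the metric axioms, since only \<open>x\<close> has distance zero from \<open>x\<close>.
\<close>

lemma isosceles_free_iff_inj_on:
  "isosceles_free X \<longleftrightarrow> (\<forall>x\<in>mspace X. inj_on (mdist X x) (mspace X))"
proof
  assume X: "isosceles_free X"
  show "\<forall>x\<in>mspace X. inj_on (mdist X x) (mspace X)"
  proof (intro ballI inj_onI)
    fix x y z assume *: "x \<in> mspace X" "y \<in> mspace X" "z \<in> mspace X" "mdist X x y = mdist X x z"
    then have "x = y \<longleftrightarrow> x = z"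
      by (metis mdist_zero)
    then show "y = z"
      using X * unfolding isosceles_free_def by blast
  qed
qed (auto simp: isosceles_free_def inj_on_def)

lemma delta_le_card:
  assumes "finite (mspace X)" "mspace X \<noteq> {}" "k_homogeneous 1 X"
  shows "delta X \<le> card (mspace X)"
  using delta_eq_card_distances_from_point[OF assms(3)] card_image_le[OF assms(1)] assms(2)
  by (metis ex_in_conv)

lemma delta_eq_card_iff_isosceles_free:
  assumes "finite (mspace X)" "mspace X \<noteq> {}" "k_homogeneous 1 X"
  shows "delta X = card (mspace X) \<longleftrightarrow> isosceles_free X"
proof -
  have "delta X = card (mspace X) \<longleftrightarrow> inj_on (mdist X x) (mspace X)" if "x \<in> mspace X" for x
    using delta_eq_card_distances_from_point[OF assms(3) that] inj_on_iff_eq_card[OF assms(1)]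
    by metis
  then show ?thesis
    using assms(2) unfolding isosceles_free_iff_inj_on by blast
qed

section \<open>Isosceles-free spaces\<close>

text \<open>
  Once the image of one point is known, the image of any other point is determined by its distance
  from there. This rigidity makes extensions unique and gives both ultrahomogeneity and the group structure below.
\<close>

lemma isosceles_free_eqI:
  assumes "isosceles_free X" "x \<in> mspace X" "y \<in> mspace X" "z \<in> mspace X"
    and "mdist X x y = mdist X x z"
  shows "y = z"
  using assms unfolding isosceles_free_iff_inj_on by (meson inj_onD)

lemma isosceles_free_Aut_eqI:
  assumes X: "isosceles_free X" and F: "F \<in> Aut X" and G: "G \<in> Aut X"
    and a: "a \<in> mspace X" "F a = G a" and x: "x \<in> mspace X"
  shows "F x = G x"
proof (rule isosceles_free_eqI[OF X, of "F a"])
  show "mdist X (F a) (F x) = mdist X (F a) (G x)"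
    using Aut_mdist[OF F a(1) x] Aut_mdist[OF G a(1) x] a(2) by simp
qed (use Aut_mspace[OF F] Aut_mspace[OF G] a x in auto)

lemma id_in_Aut: "id \<in> Aut X"
  by (simp add: Aut_def isometry_def)

lemma comp_in_Aut: "F \<in> Aut X \<Longrightarrow> G \<in> Aut X \<Longrightarrow> F \<circ> G \<in> Aut X"
  by (simp add: Aut_def isometry_comp)

lemma isosceles_free_imp_ultrahomogeneous:
  assumes hom: "k_homogeneous 1 X" and X: "isosceles_free X"
  shows "ultrahomogeneous X"
  unfolding ultrahomogeneous_def k_homogeneous_def
proof (intro allI impI)
  fix A B f
  assume A: "A \<subseteq> mspace X" and B: "B \<subseteq> mspace X"
    and f: "isometry (submetric X A) (submetric X B) f"
  have fB: "f x \<in> B" if "x \<in> A" for x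
    using f that A B by (auto simp: isometry_def Int_absorb2 dest!: bij_betwE)
  have fd: "mdist X (f x) (f y) = mdist X x y" if "x \<in> A" "y \<in> A" for x y
    using f that A by (auto simp: isometry_def)
  show "\<exists>F\<in>Aut X. \<forall>x\<in>A. F x = f x"
  proof (cases "A = {}")
    case True
    then show ?thesis
      using id_in_Aut by blast
  next
    case False
    then obtain a where a: "a \<in> A"
      by blast
    then obtain F where F: "F \<in> Aut X" "F a = f a"
      using Aut_transitive[OF hom, of a "f a"] A B fB by blast
    have "F x = f x" if x: "x \<in> A" for x
    proof (rule isosceles_free_eqI[OF X, of "f a"])
      show "mdist X (f a) (F x) = mdist X (f a) (f x)"
        using Aut_mdist[OF F(1), of a x] F(2) fd[OF a x] a x A by auto
    qed (use A B a x fB Aut_mspace[OF F(1)] in auto)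
    then show ?thesis
      using F(1) by blast
  qed
qed

text \<open>
  Transitivity and rigidity identify a point with the automorphism that sends the base
  point to it, so composition of automorphisms makes the points a group. If \<open>F\<close> sends \<open>o'\<close> to
  \<open>a\<close>, then \<open>F a\<close> and \<open>o'\<close> have the same distance from \<open>a\<close> because distance is symmetric.
  Hence \<open>F a = o'\<close>, and every element of the group is its own inverse.
\<close>

lemma isosceles_free_imp_card_power_of_two:
  assumes fin: "finite (mspace X)" and ne: "mspace X \<noteq> {}"
    and hom: "k_homogeneous 1 X" and X: "isosceles_free X"
  shows "\<exists>m. card (mspace X) = 2 ^ m"
proof -
  obtain o' where o': "o' \<in> mspace X"
    using ne by blast
  have "\<exists>F. F \<in> Aut X \<and> F o' = a" if "a \<in> mspace X" for a
    using Aut_transitive[OF hom o' that] by blast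
  then obtain t where t: "\<And>a. a \<in> mspace X \<Longrightarrow> t a \<in> Aut X" "\<And>a. a \<in> mspace X \<Longrightarrow> t a o' = a"
    by metis
  have t_mspace: "t a b \<in> mspace X" if "a \<in> mspace X" "b \<in> mspace X" for a b
    using Aut_mspace[OF t(1)] that by simp
  have t_self: "t a a = o'" if a: "a \<in> mspace X" for a
  proof (rule isosceles_free_eqI[OF X, of a])
    show "mdist X a (t a a) = mdist X a o'"
      using Aut_mdist[OF t(1)[OF a] o' a] t(2)[OF a] by (simp add: mdist_commute)
  qed (use a o' t_mspace in auto)
  have t_one: "t o' b = b" if b: "b \<in> mspace X" for b
    using isosceles_free_Aut_eqI[OF X t(1)[OF o'] id_in_Aut o' _ b] t(2)[OF o'] by simp
  have t_assoc: "t (t a b) c = t a (t b c)"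
    if abc: "a \<in> mspace X" "b \<in> mspace X" "c \<in> mspace X" for a b c
    using isosceles_free_Aut_eqI[OF X t(1) comp_in_Aut[OF t(1) t(1)] o' _ abc(3), of "t a b" a b]
      abc t(2) t_mspace by simp
  define G where "G = \<lparr>carrier = mspace X, mult = t, one = o'\<rparr>"
  have "group G"
    by (rule groupI) (use o' t_mspace t_self in \<open>auto simp: G_def t_one t_assoc\<close>)
  then interpret group G .
  have "\<exists>m. order G = 2 ^ m"
    by (rule order_power_of_two_if_exponent_two) (use fin t_self in \<open>auto simp: G_def\<close>)
  then show ?thesis
    by (simp add: order_def G_def)
qed

section \<open>The nim metric\<close>

text \<open>
  Exclusive or is binary addition with the carries dropped, hence bounded by the sum. This is
  what makes the triangle inequality hold.
\<close>

lemma xor_le_add: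
  fixes a b :: nat
  shows "xor a b \<le> a + b"
proof (induction a arbitrary: b rule: less_induct)
  case (less a)
  show ?case
  proof (cases "a = 0")
    case False
    then have "xor (a div 2) (b div 2) \<le> a div 2 + b div 2"
      by (intro less) simp
    then show ?thesis
      by (subst xor_rec) (auto simp: of_bool_def elim!: evenE oddE)
  qed simp
qed

lemma xor_less_power_of_two:
  fixes a b :: nat
  assumes "a < 2 ^ m" "b < 2 ^ m"
  shows "xor a b < 2 ^ m"
  using assms by (metis take_bit_xor take_bit_nat_eq_self_iff)

lemma xor_cancel_left: "xor a (xor a b) = (b :: nat)"
  by (simp flip: xor.assoc)

text \<open>
  Numbers below \<open>2 ^ m\<close> are read as bit vectors of length \<open>m\<close>. Translation by a fixed vector is
  an automorphism, and some translation takes any given point to any other, so the space is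
  1-homogeneous. It is isosceles-free because \<open>x\<close> and \<open>xor x y\<close> determine \<open>y\<close>.
\<close>

lemma ex_isosceles_free_homogeneous:
  obtains X :: "nat metric" where "finite (mspace X)" "card (mspace X) = 2 ^ m"
    "k_homogeneous 1 X" "isosceles_free X"
proof -
  interpret Metric_space "{..<2 ^ m :: nat}" "\<lambda>x y. real (xor x y)"
  proof
    fix x y z :: nat
    show "real (xor x y) = 0 \<longleftrightarrow> x = y"
      using xor_cancel_left[of x y] by auto
    have "xor x z = xor (xor x y) (xor y z)"
      by (simp add: xor.assoc xor_cancel_left)
    then show "real (xor x z) \<le> real (xor x y) + real (xor y z)"
      using xor_le_add[of "xor x y" "xor y z"] by (simp flip: of_nat_add)
  qed (simp_all add: xor.commute)
  have hom: "k_homogeneous 1 Self"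
    unfolding k_homogeneous_def
  proof (intro allI impI)
    fix A B f
    assume A: "A \<subseteq> mspace Self" and B: "B \<subseteq> mspace Self" and "finite A" "card A \<le> 1"
      and f: "isometry (submetric Self A) (submetric Self B) f"
    then consider "A = {}" | a where "A = {a}"
      by (metis One_nat_def card_1_singletonE card_eq_0_iff le_Suc_eq le_zero_eq)
    then show "\<exists>F\<in>Aut Self. \<forall>x\<in>A. F x = f x"
    proof cases
      case 1
      then show ?thesis
        using id_in_Aut by blast
    next
      case 2
      \<comment> \<open>the translation that takes \<open>a\<close> to \<open>f a\<close>\<close>
      define c where "c = xor a (f a)"
      have "f a \<in> B"
        using f A B 2 by (auto simp: isometry_def Int_absorb2 dest!: bij_betwE)
      then have c: "c < 2 ^ m"
        unfolding c_def using A B 2 by (intro xor_less_power_of_two) auto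
      have "bij_betw (xor c) {..<2 ^ m} {..<2 ^ m}"
        by (rule bij_betw_byWitness[where f' = "xor c"])
          (use c in \<open>auto simp: xor_cancel_left intro: xor_less_power_of_two\<close>)
      moreover have "xor (xor c x) (xor c y) = xor x y" for x y
        by (simp add: xor.commute xor.left_commute xor_cancel_left)
      ultimately have "xor c \<in> Aut Self"
        by (simp add: Aut_def isometry_def)
      moreover have "xor c a = f a"
        unfolding c_def by (simp add: xor.commute[of "xor a (f a)"] xor_cancel_left)
      ultimately show ?thesis
        using 2 by blast
    qed
  qed
  have "isosceles_free Self"
    unfolding isosceles_free_def mspace_Self mdist_Self of_nat_eq_iff by (metis xor_cancel_left)
  then show thesis
    using that[of Self] hom by simp
qed

section \<open>The extremal values\<close>

lemma one_homogeneous_bounds: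
  assumes fin: "finite (mspace X)" and ne: "mspace X \<noteq> {}" and hom: "k_homogeneous 1 X"
  shows "delta X \<le> card (mspace X) \<and>
    (delta X = card (mspace X) \<longleftrightarrow> isosceles_free X) \<and>
    (delta X = card (mspace X) \<longrightarrow> ultrahomogeneous X \<and> (\<exists>m::nat. card (mspace X) = 2 ^ m))"
  using delta_le_card[OF assms] delta_eq_card_iff_isosceles_free[OF assms]
    isosceles_free_imp_ultrahomogeneous[OF hom]
    isosceles_free_imp_card_power_of_two[OF assms]
  by auto

lemma Delta_1_le:
  assumes "n \<ge> 1"
  shows "Delta 1 n \<le> n"
proof -
  obtain X :: "nat metric" where X: "finite (mspace X)" "card (mspace X) = n"
    "k_homogeneous 1 X" "delta X = Delta 1 n"
    by (rule Delta_attained)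
  have "mspace X \<noteq> {}"
    using X(2) assms by auto
  then show ?thesis
    using delta_le_card[OF X(1) _ X(3)] X(2,4) by simp
qed

lemma Delta_omega_le_Delta: "Delta_omega n \<le> Delta k n"
proof -
  obtain X :: "nat metric" where X: "finite (mspace X)" "card (mspace X) = n"
    "ultrahomogeneous X" "delta X = Delta_omega n"
    by (rule Delta_omega_attained)
  then show ?thesis
    using Delta_ge[OF X(1,2) k_homogeneous_if_ultrahomogeneous] by metis
qed

lemma Delta_omega_power_of_two_ge: "2 ^ m \<le> Delta_omega (2 ^ m)"
proof -
  obtain X :: "nat metric" where X: "finite (mspace X)" "card (mspace X) = 2 ^ m"
    "k_homogeneous 1 X" "isosceles_free X"
    by (rule ex_isosceles_free_homogeneous)
  have "mspace X \<noteq> {}"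
    using X(2) by auto
  then have "delta X = 2 ^ m"
    using delta_eq_card_iff_isosceles_free[OF X(1) _ X(3)] X(2,4) by simp
  then show ?thesis
    using Delta_omega_ge[OF X(1,2) isosceles_free_imp_ultrahomogeneous[OF X(3,4)]] by simp
qed

text \<open>The maximum is attained, so its value is the number of distances of an actual space.\<close>

lemma Delta_1_eq_imp_power_of_two:
  assumes "n \<ge> 1" "Delta 1 n = n"
  shows "\<exists>m::nat. n = 2 ^ m"
proof -
  obtain X :: "nat metric" where X: "finite (mspace X)" "card (mspace X) = n"
    "k_homogeneous 1 X" "delta X = Delta 1 n"
    by (rule Delta_attained)
  have "mspace X \<noteq> {}"
    using X(2) assms(1) by auto
  then show ?thesis
    using one_homogeneous_bounds[OF X(1) _ X(3)] X(2,4) assms(2) by simp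
qed

theorem proposition6p3:
  fixes n :: nat
  assumes "n \<ge> 1"
  shows "(\<forall>X :: 'a metric. finite (mspace X) \<and> card (mspace X) = n \<and> k_homogeneous 1 X \<longrightarrow>
            delta X \<le> n \<and>
            (delta X = n \<longleftrightarrow> isosceles_free X) \<and>
            (delta X = n \<longrightarrow> ultrahomogeneous X \<and> (\<exists>m::nat. n = 2 ^ m))) \<and>
         ((\<exists>m::nat. n = 2 ^ m) \<longrightarrow> Delta_omega n = n \<and> Delta 1 n = n) \<and>
         ((\<nexists>m::nat. n = 2 ^ m) \<longrightarrow> Delta 1 n < n)"
proof (intro conjI allI impI; (elim conjE exE)?)
  fix X :: "'a metric"
  assume X: "finite (mspace X)" "card (mspace X) = n" "k_homogeneous 1 X"
  then have "mspace X \<noteq> {}"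
    using assms by auto
  note bounds = one_homogeneous_bounds[OF X(1) this X(3), unfolded X(2)]
  show "delta X \<le> n"
    using bounds by blast
  show "delta X = n \<longleftrightarrow> isosceles_free X"
    using bounds by blast
  show "ultrahomogeneous X" if "delta X = n"
    using bounds that by blast
  show "\<exists>m::nat. n = 2 ^ m" if "delta X = n"
    using bounds that by blast
next
  fix m assume m: "n = 2 ^ m"
  have "n \<le> Delta_omega n" "Delta_omega n \<le> Delta 1 n" "Delta 1 n \<le> n"
    using Delta_omega_power_of_two_ge[of m] Delta_omega_le_Delta Delta_1_le[OF assms]
    by (simp_all add: m)
  then show "Delta_omega n = n" "Delta 1 n = n"
    by simp_all
next
  assume "\<nexists>m::nat. n = 2 ^ m"
  then show "Delta 1 n < n"
    using Delta_1_eq_imp_power_of_two[OF assms] Delta_1_le[OF assms] by fastforce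
qed

end
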